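(* Daletskii–Takhtajan's functor $\mathfrak{D}_n$ does not preserve perfect objects in general: there exist a field $\mathbb{K}$, a natural number $n\ge 2$ and a perfect Leibniz $n$-algebra $\mathcal{L}$ over $\mathbb{K}$ such that the Leibniz algebra $\mathfrak{D}_n(\mathcal{L})$ is not perfect.
   Context: A Leibniz $n$-algebra over a field $\mathbb{K}$ is a vector space $\mathcal{L}$ with an $n$-linear bracket satisfying $[[x_1,\dots,x_n],y_2,\dots,y_n]=\sum_{i=1}^n[x_1,\dots,x_{i-1},[x_i,y_2,\dots,y_n],x_{i+1},\dots,x_n]$; a Leibniz algebra is a Leibniz $2$-algebra. It is perfect if it equals the linear span of all its $n$-ary brackets. For a Leibniz $n$-algebra $\mathcal{L}$, $\mathfrak{D}_n(\mathcal{L})$ is the Leibniz algebra with underlying vector space $\mathcal{L}^{\otimes(n-1)}$ and bracket \[ [l_1\otimes\cdots\otimes l_{n-1},l_1'\otimes\cdots\otimes l_{n-1}']=\sum_{i=1}^{n-1}l_1\otimes\cdots\otimes[l_i,l_1',\dots,l_{n-1}']\otimes\cdots\otimes l_{n-1}. \] *)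

theory Defs
  imports Complex_Main "HOL-Algebra.Module" "HOL-Algebra.AbelCoset"
begin

text \<open>
  Vector spaces are modules (in the sense of \<^locale>\<open>module\<close>) over a ring record that is a
  \<^locale>\<open>field\<close>. The fields \<^const>\<open>mult\<close> and \<^const>\<open>one\<close>, which module records inherit from
  rings, play no role for vector spaces and are left undefined in the constructions below.
\<close>

definition lin_span :: "('k, 'm) ring_scheme \<Rightarrow> ('k, 'v, 'n) module_scheme \<Rightarrow> 'v set \<Rightarrow> 'v set" where
  "lin_span K V S = \<Inter>{H. submodule H K V \<and> S \<subseteq> H}"

definition tuples :: "('v, 'n) ring_scheme \<Rightarrow> nat \<Rightarrow> 'v list set" where
  "tuples V m = {xs. length xs = m \<and> set xs \<subseteq> carrier V}"

definition multilinear ::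
  "('k, 'm) ring_scheme \<Rightarrow> ('k, 'v, 'n) module_scheme \<Rightarrow> nat \<Rightarrow> ('v list \<Rightarrow> 'v) \<Rightarrow> bool" where
  "multilinear K V n \<phi> \<longleftrightarrow>
     (\<forall>xs \<in> tuples V n. \<phi> xs \<in> carrier V) \<and>
     (\<forall>xs \<in> tuples V n. \<forall>i < n. \<forall>x \<in> carrier V. \<forall>y \<in> carrier V.
        \<phi> (xs[i := x \<oplus>\<^bsub>V\<^esub> y]) = \<phi> (xs[i := x]) \<oplus>\<^bsub>V\<^esub> \<phi> (xs[i := y])) \<and>
     (\<forall>xs \<in> tuples V n. \<forall>i < n. \<forall>a \<in> carrier K. \<forall>x \<in> carrier V.
        \<phi> (xs[i := a \<odot>\<^bsub>V\<^esub> x]) = a \<odot>\<^bsub>V\<^esub> \<phi> (xs[i := x]))"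


section \<open>Leibniz n-algebras\<close>

record ('k, 'v) nary_algebra = "('k, 'v) module" +
  bracket :: "'v list \<Rightarrow> 'v"

locale leibniz_n_algebra = K?: field K + L?: module K L
  for K :: "('k, 'm) ring_scheme" and n :: nat and L :: "('k, 'v, 'l) nary_algebra_scheme" +
  assumes bracket_multilinear: "multilinear K L n (bracket L)"
    and fundamental_identity:
      "\<lbrakk>xs \<in> tuples L n; ys \<in> tuples L (n - 1)\<rbrakk> \<Longrightarrow>
        bracket L (bracket L xs # ys) =
        (\<Oplus>\<^bsub>L\<^esub>i\<in>{..<n}. bracket L (xs[i := bracket L (xs ! i # ys)]))"

abbreviation leibniz_algebra ::
  "('k, 'm) ring_scheme \<Rightarrow> ('k, 'v, 'l) nary_algebra_scheme \<Rightarrow> bool" where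
  "leibniz_algebra K L \<equiv> leibniz_n_algebra K 2 L"

definition perfect ::
  "('k, 'm) ring_scheme \<Rightarrow> nat \<Rightarrow> ('k, 'v, 'l) nary_algebra_scheme \<Rightarrow> bool" where
  "perfect K n L \<longleftrightarrow> carrier L = lin_span K L (bracket L ` tuples L n)"


section \<open>Tensor powers\<close>

definition free_module :: "('k, 'm) ring_scheme \<Rightarrow> 'b set \<Rightarrow> ('k, 'b \<Rightarrow> 'k) module" where
  "free_module K B =
    \<lparr>carrier = {f. (\<forall>b. f b \<in> carrier K) \<and> (\<forall>b. b \<notin> B \<longrightarrow> f b = \<zero>\<^bsub>K\<^esub>) \<and>
                   finite {b. f b \<noteq> \<zero>\<^bsub>K\<^esub>}},
     mult = undefined,
     one = undefined,
     zero = (\<lambda>b. \<zero>\<^bsub>K\<^esub>),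
     add = (\<lambda>f g b. f b \<oplus>\<^bsub>K\<^esub> g b),
     smult = (\<lambda>a f b. a \<otimes>\<^bsub>K\<^esub> f b)\<rparr>"

definition unit_vec :: "('k, 'm) ring_scheme \<Rightarrow> 'b \<Rightarrow> 'b \<Rightarrow> 'k" where
  "unit_vec K b = (\<lambda>c. if c = b then \<one>\<^bsub>K\<^esub> else \<zero>\<^bsub>K\<^esub>)"

text \<open>The linear extension to a free module of a map defined on its basis.\<close>

definition linear_extension ::
  "('k, 'm) ring_scheme \<Rightarrow> ('k, 'v, 'n) module_scheme \<Rightarrow> ('b \<Rightarrow> 'v) \<Rightarrow> ('b \<Rightarrow> 'k) \<Rightarrow> 'v" where
  "linear_extension K V \<phi> f = (\<Oplus>\<^bsub>V\<^esub>b\<in>{b. f b \<noteq> \<zero>\<^bsub>K\<^esub>}. f b \<odot>\<^bsub>V\<^esub> \<phi> b)"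

definition quotient_module :: "('k, 'v, 'n) module_scheme \<Rightarrow> 'v set \<Rightarrow> ('k, 'v set) module" where
  "quotient_module V N =
    \<lparr>carrier = a_rcosets\<^bsub>V\<^esub> N,
     mult = undefined,
     one = undefined,
     zero = N,
     add = set_add V,
     smult = (\<lambda>a X. \<Union>x\<in>X. N +>\<^bsub>V\<^esub> (a \<odot>\<^bsub>V\<^esub> x))\<rparr>"

text \<open>
  The \<open>m\<close>-th tensor power of \<open>V\<close> is the free vector space on \<open>m\<close>-tuples of vectors modulo
  the subspace generated by the multilinearity relations.
\<close>

abbreviation tensor_free ::
  "('k, 'm) ring_scheme \<Rightarrow> ('k, 'v, 'n) module_scheme \<Rightarrow> nat \<Rightarrow> ('k, 'v list \<Rightarrow> 'k) module" where
  "tensor_free K V m \<equiv> free_module K (tuples V m)"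

definition tensor_relations ::
  "('k, 'm) ring_scheme \<Rightarrow> ('k, 'v, 'n) module_scheme \<Rightarrow> nat \<Rightarrow> ('v list \<Rightarrow> 'k) set" where
  "tensor_relations K V m = lin_span K (tensor_free K V m)
    ({unit_vec K (xs[i := x \<oplus>\<^bsub>V\<^esub> y]) \<ominus>\<^bsub>tensor_free K V m\<^esub>
        (unit_vec K (xs[i := x]) \<oplus>\<^bsub>tensor_free K V m\<^esub> unit_vec K (xs[i := y])) | xs i x y.
        xs \<in> tuples V m \<and> i < m \<and> x \<in> carrier V \<and> y \<in> carrier V} \<union>
     {unit_vec K (xs[i := a \<odot>\<^bsub>V\<^esub> x]) \<ominus>\<^bsub>tensor_free K V m\<^esub>
        (a \<odot>\<^bsub>tensor_free K V m\<^esub> unit_vec K (xs[i := x])) | xs i a x.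
        xs \<in> tuples V m \<and> i < m \<and> a \<in> carrier K \<and> x \<in> carrier V})"

definition tensor_power ::
  "('k, 'm) ring_scheme \<Rightarrow> ('k, 'v, 'n) module_scheme \<Rightarrow> nat \<Rightarrow> ('k, ('v list \<Rightarrow> 'k) set) module" where
  "tensor_power K V m = quotient_module (tensor_free K V m) (tensor_relations K V m)"


section \<open>The Daletskii--Takhtajan construction\<close>

text \<open>
  The bracket on the \<open>m\<close>-th tensor power of \<open>L\<close>, \<open>m = n - 1\<close>, is first extended bilinearly
  from pairs of tuples to the free vector space on tuples, and then passed to cosets.
\<close>

definition dt_free_bracket ::
  "('k, 'm) ring_scheme \<Rightarrow> nat \<Rightarrow> ('k, 'v, 'l) nary_algebra_scheme \<Rightarrow>
   ('v list \<Rightarrow> 'k) \<Rightarrow> ('v list \<Rightarrow> 'k) \<Rightarrow> ('v list \<Rightarrow> 'k)" where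
  "dt_free_bracket K m L f g =
    linear_extension K (tensor_free K L m) (\<lambda>xs.
      linear_extension K (tensor_free K L m) (\<lambda>ys.
        \<Oplus>\<^bsub>tensor_free K L m\<^esub>i\<in>{..<m}. unit_vec K (xs[i := bracket L (xs ! i # ys)])) g) f"

definition daletskii_takhtajan ::
  "('k, 'm) ring_scheme \<Rightarrow> nat \<Rightarrow> ('k, 'v, 'l) nary_algebra_scheme \<Rightarrow>
   ('k, ('v list \<Rightarrow> 'k) set) nary_algebra" where
  "daletskii_takhtajan K n L = module.extend (tensor_power K L (n - 1))
    (nary_algebra.fields (\<lambda>Xs. \<Union>f\<in>Xs ! 0. \<Union>g\<in>Xs ! 1.
       tensor_relations K L (n - 1) +>\<^bsub>tensor_free K L (n - 1)\<^esub>
         dt_free_bracket K (n - 1) L f g))"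

end

theory Submission
  imports Defs
begin

text \<open>
  Over the field with two elements let \<open>L\<close> be the one-dimensional space with the ternary bracket
  \<open>[x, y, z] = x y z\<close>. Each of the three terms on the right of the fundamental identity equals
  \<open>x y z u v\<close>, and \<open>3 = 1\<close>, so \<open>L\<close> is a perfect Leibniz 3-algebra. The bracket of
  \<open>L \<otimes> L\<close> is a sum of two equal terms, hence zero, whereas \<open>L \<otimes> L\<close> is not zero.
\<close>

section \<open>Free modules, spans and quotients\<close>

lemma free_module_simps [simp]:
  "f \<in> carrier (free_module K B) \<longleftrightarrow>
     (\<forall>b. f b \<in> carrier K) \<and> (\<forall>b. b \<notin> B \<longrightarrow> f b = \<zero>\<^bsub>K\<^esub>) \<and> finite {b. f b \<noteq> \<zero>\<^bsub>K\<^esub>}"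
  "\<zero>\<^bsub>free_module K B\<^esub> = (\<lambda>b. \<zero>\<^bsub>K\<^esub>)"
  "f \<oplus>\<^bsub>free_module K B\<^esub> g = (\<lambda>b. f b \<oplus>\<^bsub>K\<^esub> g b)"
  "a \<odot>\<^bsub>free_module K B\<^esub> f = (\<lambda>b. a \<otimes>\<^bsub>K\<^esub> f b)"
  by (auto simp: free_module_def)

text \<open>The module axioms hold pointwise in \<open>R\<close>. What remains is finite support:
  sums, negatives and multiples vanish outside the supports of their arguments.\<close>

lemma (in cring) free_module_module: "module R (free_module R B)"
proof (rule moduleI)
  show "cring R" by (rule is_cring)
  have add_closed: "f \<oplus>\<^bsub>free_module R B\<^esub> g \<in> carrier (free_module R B)"
    if "f \<in> carrier (free_module R B)" "g \<in> carrier (free_module R B)" for f g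
  proof -
    have "{b. f b \<oplus> g b \<noteq> \<zero>} \<subseteq> {b. f b \<noteq> \<zero>} \<union> {b. g b \<noteq> \<zero>}" by auto
    then have "finite {b. f b \<oplus> g b \<noteq> \<zero>}"
      using that by (auto intro: finite_subset)
    then show ?thesis using that by simp
  qed
  show "abelian_group (free_module R B)"
  proof (rule abelian_groupI)
    fix f assume f: "f \<in> carrier (free_module R B)"
    have "{b. \<ominus> f b \<noteq> \<zero>} \<subseteq> {b. f b \<noteq> \<zero>}" by auto
    then have "finite {b. \<ominus> f b \<noteq> \<zero>}"
      using f by (auto intro: finite_subset)
    then have "(\<lambda>b. \<ominus> f b) \<in> carrier (free_module R B)"
      using f by simp
    moreover have "(\<lambda>b. \<ominus> f b) \<oplus>\<^bsub>free_module R B\<^esub> f = \<zero>\<^bsub>free_module R B\<^esub>"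
      using f by (simp add: l_neg)
    ultimately show "\<exists>g\<in>carrier (free_module R B). g \<oplus>\<^bsub>free_module R B\<^esub> f = \<zero>\<^bsub>free_module R B\<^esub>"
      by blast
  qed (use add_closed in \<open>simp_all add: a_ac\<close>)
  show "a \<odot>\<^bsub>free_module R B\<^esub> f \<in> carrier (free_module R B)"
    if "a \<in> carrier R" "f \<in> carrier (free_module R B)" for a f
  proof -
    have "{b. a \<otimes> f b \<noteq> \<zero>} \<subseteq> {b. f b \<noteq> \<zero>}" using that by auto
    then have "finite {b. a \<otimes> f b \<noteq> \<zero>}"
      using that by (auto intro: finite_subset)
    then show ?thesis using that by simp
  qed
qed (simp_all add: l_distr r_distr m_assoc)

lemma (in cring) unit_vec_closed:
  assumes "b \<in> B"
  shows "unit_vec R b \<in> carrier (free_module R B)"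
proof -
  have "{c. unit_vec R b c \<noteq> \<zero>} \<subseteq> {b}" by (auto simp: unit_vec_def)
  then have "finite {c. unit_vec R b c \<noteq> \<zero>}" by (rule finite_subset) simp
  then show ?thesis using assms by (auto simp: unit_vec_def)
qed

section \<open>Submodules and linear spans\<close>

context module
begin

lemma submodule_memD:
  assumes "submodule H R M"
  shows "H \<subseteq> carrier M" "\<zero>\<^bsub>M\<^esub> \<in> H" "a \<in> H \<Longrightarrow> \<ominus>\<^bsub>M\<^esub> a \<in> H"
    "a \<in> H \<Longrightarrow> b \<in> H \<Longrightarrow> a \<oplus>\<^bsub>M\<^esub> b \<in> H" "r \<in> carrier R \<Longrightarrow> a \<in> H \<Longrightarrow> r \<odot>\<^bsub>M\<^esub> a \<in> H"
proof -
  interpret submodule H R M by fact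
  show "H \<subseteq> carrier M" "\<zero>\<^bsub>M\<^esub> \<in> H" "a \<in> H \<Longrightarrow> \<ominus>\<^bsub>M\<^esub> a \<in> H"
    "a \<in> H \<Longrightarrow> b \<in> H \<Longrightarrow> a \<oplus>\<^bsub>M\<^esub> b \<in> H" "r \<in> carrier R \<Longrightarrow> a \<in> H \<Longrightarrow> r \<odot>\<^bsub>M\<^esub> a \<in> H"
    using subset one_closed m_inv_closed m_closed by (auto simp: a_inv_def)
qed

lemma submodule_carrier: "submodule (carrier M) R M"
  by (rule submoduleI) auto

text \<open>The span is an intersection of submodules. The whole carrier is one of them, which
  bounds the intersection.\<close>

lemma submodule_lin_span:
  assumes "S \<subseteq> carrier M"
  shows "submodule (lin_span R M S) R M"
proof (rule submoduleI)
  show "lin_span R M S \<subseteq> carrier M"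
    using assms submodule_carrier by (auto simp: lin_span_def)
qed (auto simp: lin_span_def intro: submodule_memD)

lemma lin_span_superset: "S \<subseteq> lin_span R M S"
  by (auto simp: lin_span_def)

lemma lin_span_least:
  assumes "submodule H R M" "S \<subseteq> H"
  shows "lin_span R M S \<subseteq> H"
  using assms by (auto simp: lin_span_def)

lemma submodule_finsum:
  assumes H: "submodule H R M" and "\<And>i. i \<in> A \<Longrightarrow> f i \<in> H"
  shows "(\<Oplus>\<^bsub>M\<^esub>i\<in>A. f i) \<in> H"
proof (cases "finite A")
  case True
  then show ?thesis using assms(2)
  proof (induction A)
    case (insert i A)
    then have "f \<in> insert i A \<rightarrow> carrier M"
      using submodule_memD(1)[OF H] by auto
    with insert show ?case
      by (simp add: Pi_def submodule_memD(4)[OF H])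
  qed (simp add: submodule_memD(2)[OF H])
\<comment> \<open>Over an infinite index set the sum defaults to zero, which lies in every
  submodule.\<close>
qed (simp add: M.finsum_infinite submodule_memD(2)[OF H])

text \<open>Reduces membership of a linear extension to the values on the basis, since the support
  of \<open>f\<close> lies in \<open>B\<close>. Applied once for each argument, it controls
  \<open>dt_free_bracket\<close>.\<close>

lemma submodule_linear_extension:
  assumes "submodule H R M" "f \<in> carrier (free_module R B)" "\<And>b. b \<in> B \<Longrightarrow> \<phi> b \<in> H"
  shows "linear_extension R M \<phi> f \<in> H"
  unfolding linear_extension_def
  using assms by (intro submodule_finsum submodule_memD(5)) auto

section \<open>Quotient modules\<close>

lemma submodule_abelian_subgroup:
  assumes "submodule N R M"
  shows "abelian_subgroup N M"
  using assms by (intro abelian_subgroupI3 additive_subgroup.intro submodule.axioms(1) M.abelian_group_axioms)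

text \<open>Two representatives of a coset differ by some \<open>h\<close> in \<open>N\<close>, and
  the multiple of \<open>h\<close> by \<open>a\<close> stays in \<open>N\<close>. So all cosets in
  the union that defines the scalar action coincide.\<close>

lemma quotient_smult:
  assumes N: "submodule N R M" and a: "a \<in> carrier R" and x: "x \<in> carrier M"
  shows "a \<odot>\<^bsub>quotient_module M N\<^esub> (N +>\<^bsub>M\<^esub> x) = N +>\<^bsub>M\<^esub> (a \<odot>\<^bsub>M\<^esub> x)"
proof -
  interpret Q: abelian_subgroup N M
    by (rule submodule_abelian_subgroup[OF N])
  have "N +>\<^bsub>M\<^esub> (a \<odot>\<^bsub>M\<^esub> y) = N +>\<^bsub>M\<^esub> (a \<odot>\<^bsub>M\<^esub> x)" if y: "y \<in> N +>\<^bsub>M\<^esub> x" for y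
  proof -
    obtain h where h: "h \<in> N" "y = h \<oplus>\<^bsub>M\<^esub> x"
      using y by (auto simp: a_r_coset_def')
    then have "a \<odot>\<^bsub>M\<^esub> y = a \<odot>\<^bsub>M\<^esub> h \<oplus>\<^bsub>M\<^esub> a \<odot>\<^bsub>M\<^esub> x"
      using a x submodule_memD(1)[OF N] by (auto simp: smult_r_distr)
    then have "a \<odot>\<^bsub>M\<^esub> y \<in> N +>\<^bsub>M\<^esub> (a \<odot>\<^bsub>M\<^esub> x)"
      using submodule_memD(5)[OF N a h(1)] by (auto simp: a_r_coset_def')
    then show ?thesis
      using a x Q.a_repr_independence' by simp
  qed
  then have "(\<Union>y\<in>N +>\<^bsub>M\<^esub> x. N +>\<^bsub>M\<^esub> (a \<odot>\<^bsub>M\<^esub> y)) = N +>\<^bsub>M\<^esub> (a \<odot>\<^bsub>M\<^esub> x)"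
    using Q.a_rcos_self[OF x] by blast
  then show ?thesis
    unfolding quotient_module_def by simp
qed

lemma quotient_module_module:
  assumes N: "submodule N R M"
  shows "module R (quotient_module M N)"
proof -
  interpret Q: abelian_subgroup N M
    by (rule submodule_abelian_subgroup[OF N])
  let ?Q = "quotient_module M N"
  \<comment> \<open>With \<open>carr\<close>, \<open>add\<close>, \<open>zero\<close> and
    \<open>quotient_smult\<close>, every operation is computed on representatives, so each axiom
    descends from \<open>M\<close>.\<close>
  have carr: "X \<in> carrier ?Q \<longleftrightarrow> (\<exists>x\<in>carrier M. X = N +>\<^bsub>M\<^esub> x)" for X
    by (auto simp: quotient_module_def A_RCOSETS_def')
  have add: "(N +>\<^bsub>M\<^esub> x) \<oplus>\<^bsub>?Q\<^esub> (N +>\<^bsub>M\<^esub> y) = N +>\<^bsub>M\<^esub> (x \<oplus>\<^bsub>M\<^esub> y)"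
    if "x \<in> carrier M" "y \<in> carrier M" for x y
    using that by (simp add: quotient_module_def Q.a_rcos_sum)
  have zero: "\<zero>\<^bsub>?Q\<^esub> = N +>\<^bsub>M\<^esub> \<zero>\<^bsub>M\<^esub>"
    using submodule_memD(1)[OF N] by (simp add: quotient_module_def)
  show ?thesis
  proof (rule moduleI)
    show "abelian_group ?Q"
    proof (rule abelian_groupI)
      fix X assume "X \<in> carrier ?Q"
      then obtain x where x: "x \<in> carrier M" "X = N +>\<^bsub>M\<^esub> x" by (auto simp: carr)
      then have "N +>\<^bsub>M\<^esub> (\<ominus>\<^bsub>M\<^esub> x) \<in> carrier ?Q" "(N +>\<^bsub>M\<^esub> (\<ominus>\<^bsub>M\<^esub> x)) \<oplus>\<^bsub>?Q\<^esub> X = \<zero>\<^bsub>?Q\<^esub>"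
        by (auto simp: carr add zero M.l_neg)
      then show "\<exists>Y\<in>carrier ?Q. Y \<oplus>\<^bsub>?Q\<^esub> X = \<zero>\<^bsub>?Q\<^esub>" by blast
    next
      fix X Y assume "X \<in> carrier ?Q" "Y \<in> carrier ?Q"
      then show "X \<oplus>\<^bsub>?Q\<^esub> Y = Y \<oplus>\<^bsub>?Q\<^esub> X"
        by (auto simp: carr add M.a_comm)
    next
      fix X Y assume "X \<in> carrier ?Q" "Y \<in> carrier ?Q"
      then obtain x y where "x \<in> carrier M" "X = N +>\<^bsub>M\<^esub> x" "y \<in> carrier M" "Y = N +>\<^bsub>M\<^esub> y"
        by (auto simp: carr)
      then show "X \<oplus>\<^bsub>?Q\<^esub> Y \<in> carrier ?Q"
        unfolding carr by (intro bexI[of _ "x \<oplus>\<^bsub>M\<^esub> y"]) (simp_all add: add)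
    next
      fix X Y Z assume "X \<in> carrier ?Q" "Y \<in> carrier ?Q" "Z \<in> carrier ?Q"
      then show "(X \<oplus>\<^bsub>?Q\<^esub> Y) \<oplus>\<^bsub>?Q\<^esub> Z = X \<oplus>\<^bsub>?Q\<^esub> (Y \<oplus>\<^bsub>?Q\<^esub> Z)"
        by (auto simp: carr add M.a_assoc)
    next
      show "\<zero>\<^bsub>?Q\<^esub> \<in> carrier ?Q" unfolding zero carr by blast
    next
      fix X assume "X \<in> carrier ?Q"
      then show "\<zero>\<^bsub>?Q\<^esub> \<oplus>\<^bsub>?Q\<^esub> X = X" by (auto simp: carr add zero)
    qed
  next
    fix a X assume "a \<in> carrier R" "X \<in> carrier ?Q"
    then obtain x where "x \<in> carrier M" "X = N +>\<^bsub>M\<^esub> x"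
      by (auto simp: carr)
    with \<open>a \<in> carrier R\<close> show "a \<odot>\<^bsub>?Q\<^esub> X \<in> carrier ?Q"
      unfolding carr by (intro bexI[of _ "a \<odot>\<^bsub>M\<^esub> x"]) (simp_all add: quotient_smult[OF N])
  next
    fix a b X assume "a \<in> carrier R" "b \<in> carrier R" "X \<in> carrier ?Q"
    then show "(a \<oplus> b) \<odot>\<^bsub>?Q\<^esub> X = a \<odot>\<^bsub>?Q\<^esub> X \<oplus>\<^bsub>?Q\<^esub> b \<odot>\<^bsub>?Q\<^esub> X"
      unfolding carr by (elim bexE) (simp add: add quotient_smult[OF N] smult_l_distr)
  next
    fix a X Y assume "a \<in> carrier R" "X \<in> carrier ?Q" "Y \<in> carrier ?Q"
    then show "a \<odot>\<^bsub>?Q\<^esub> (X \<oplus>\<^bsub>?Q\<^esub> Y) = a \<odot>\<^bsub>?Q\<^esub> X \<oplus>\<^bsub>?Q\<^esub> a \<odot>\<^bsub>?Q\<^esub> Y"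
      unfolding carr by (elim bexE) (simp add: add quotient_smult[OF N] smult_r_distr)
  next
    fix a b X assume "a \<in> carrier R" "b \<in> carrier R" "X \<in> carrier ?Q"
    then show "(a \<otimes> b) \<odot>\<^bsub>?Q\<^esub> X = a \<odot>\<^bsub>?Q\<^esub> (b \<odot>\<^bsub>?Q\<^esub> X)"
      unfolding carr by (elim bexE) (simp add: quotient_smult[OF N] smult_assoc1)
  next
    fix X assume "X \<in> carrier ?Q"
    then show "\<one> \<odot>\<^bsub>?Q\<^esub> X = X"
      unfolding carr by (elim bexE) (simp add: quotient_smult[OF N])
  qed (rule R.is_cring)
qed

end

section \<open>The one-dimensional algebra over the field with two elements\<close>

text \<open>The scalar type of the theorem is \<open>real\<close>, so the field is carried by the
  real numbers 0 and 1. Their real product is already the right one; addition has to be replaced by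
  exclusive or.\<close>

definition F2 :: "real ring" where
  "F2 = \<lparr>carrier = {0, 1}, mult = (*), one = 1, zero = 0, add = (\<lambda>x y. if x = y then 0 else 1)\<rparr>"

lemma F2_simps [simp]:
  "carrier F2 = {0, 1}" "x \<otimes>\<^bsub>F2\<^esub> y = x * y" "\<one>\<^bsub>F2\<^esub> = 1" "\<zero>\<^bsub>F2\<^esub> = 0"
  "x \<oplus>\<^bsub>F2\<^esub> y = (if x = y then 0 else 1)"
  by (auto simp: F2_def)

lemma cring_F2: "cring F2"
  by (intro cringI abelian_groupI comm_monoidI) auto

lemma field_F2: "field F2"
  using cring_F2
proof (rule cring.cring_fieldI2)
  show "\<zero>\<^bsub>F2\<^esub> \<noteq> \<one>\<^bsub>F2\<^esub>" by simp
  show "\<exists>b\<in>carrier F2. a \<otimes>\<^bsub>F2\<^esub> b = \<one>\<^bsub>F2\<^esub>" if "a \<in> carrier F2" "a \<noteq> \<zero>\<^bsub>F2\<^esub>" for a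
    using that by auto
qed

abbreviation e :: "nat \<Rightarrow> real" where "e \<equiv> \<lambda>_. 1"

text \<open>The vector type of the theorem consists of functions, so the scalars 0 and 1 are
  represented by constant functions. The vector \<open>e\<close> is both the basis vector and the
  unit of the product.\<close>

definition F2_line :: "(real, nat \<Rightarrow> real) nary_algebra" where
  "F2_line = \<lparr>carrier = {\<lambda>_. 0, e}, mult = undefined, one = undefined, zero = (\<lambda>_. 0),
     add = (\<lambda>f g i. if f i = g i then 0 else 1), smult = (\<lambda>a f i. a * f i),
     bracket = (\<lambda>xs i. \<Prod>x\<leftarrow>xs. x i)\<rparr>"

lemma F2_line_simps [simp]:
  "carrier F2_line = {\<lambda>_. 0, e}" "\<zero>\<^bsub>F2_line\<^esub> = (\<lambda>_. 0)"
  "f \<oplus>\<^bsub>F2_line\<^esub> g = (\<lambda>i. if f i = g i then 0 else 1)" "a \<odot>\<^bsub>F2_line\<^esub> f = (\<lambda>i. a * f i)"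
  "bracket F2_line xs = (\<lambda>i. \<Prod>x\<leftarrow>xs. x i)"
  by (auto simp: F2_line_def)

lemma module_F2_line: "module F2 F2_line"
  by (intro moduleI abelian_groupI cring_F2) auto

lemma tuples_2E:
  assumes "xs \<in> tuples V 2"
  obtains x y where "xs = [x, y]" "x \<in> carrier V" "y \<in> carrier V"
  using assms by (auto simp: tuples_def numeral_2_eq_2 length_Suc_conv)

lemma tuples_3E:
  assumes "xs \<in> tuples V 3"
  obtains x y z where "xs = [x, y, z]" "x \<in> carrier V" "y \<in> carrier V" "z \<in> carrier V"
  using assms by (auto simp: tuples_def numeral_3_eq_3 length_Suc_conv)

lemma less_3_cases: "i < 3 \<Longrightarrow> i = 0 \<or> i = 1 \<or> i = (2::nat)"
  by auto

lemma leibniz_F2_line: "leibniz_n_algebra F2 3 F2_line"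
proof -
  interpret field F2 by (rule field_F2)
  interpret module F2 F2_line by (rule module_F2_line)
  show ?thesis
  proof
    show "multilinear F2 F2_line 3 (bracket F2_line)"
      unfolding multilinear_def
      \<comment> \<open>A finite check: three positions, with scalars and vectors from two-element
        carriers.\<close>
      by (intro conjI ballI allI impI; elim tuples_3E; (drule less_3_cases)?)
        (auto simp: fun_eq_iff)
  next
    fix xs ys assume xs: "xs \<in> tuples F2_line 3" and "ys \<in> tuples F2_line (3 - 1)"
    then have ys: "ys \<in> tuples F2_line 2" by simp
    obtain x y z where xyz: "xs = [x, y, z]" "x \<in> carrier F2_line" "y \<in> carrier F2_line"
        "z \<in> carrier F2_line"
      using xs by (rule tuples_3E)
    obtain u v where uv: "ys = [u, v]" "u \<in> carrier F2_line" "v \<in> carrier F2_line"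
      using ys by (rule tuples_2E)
    \<comment> \<open>By commutativity the inner bracket may be inserted at any position, so
      \<open>p\<close> is the value of all three terms as well as of the left side. Three copies of
      \<open>p\<close> add up to \<open>p\<close> in characteristic two.\<close>
    define p where "p = (\<lambda>i. x i * y i * z i * u i * v i)"
    have p: "p \<in> carrier F2_line"
      using xyz uv by (auto simp: p_def)
    have "bracket F2_line (xs[i := bracket F2_line (xs ! i # ys)]) = p" if "i < 3" for i
      using less_3_cases[OF that] by (auto simp: xyz uv p_def)
    then have "(\<Oplus>\<^bsub>F2_line\<^esub>i\<in>{..<3}. bracket F2_line (xs[i := bracket F2_line (xs ! i # ys)])) =
        (\<Oplus>\<^bsub>F2_line\<^esub>i\<in>{..<3::nat}. p)"
      using p by (intro M.finsum_cong') auto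
    also have "\<dots> = p \<oplus>\<^bsub>F2_line\<^esub> (p \<oplus>\<^bsub>F2_line\<^esub> p)"
      using p by (simp add: numeral_3_eq_3 lessThan_Suc del: F2_line_simps)
    also have "\<dots> = p"
      using p by auto
    also have "p = bracket F2_line (bracket F2_line xs # ys)"
      by (auto simp: xyz uv p_def)
    finally show "bracket F2_line (bracket F2_line xs # ys) =
        (\<Oplus>\<^bsub>F2_line\<^esub>i\<in>{..<3}. bracket F2_line (xs[i := bracket F2_line (xs ! i # ys)]))" ..
  qed
qed

lemma perfect_F2_line: "perfect F2 3 F2_line"
proof -
  interpret module F2 F2_line by (rule module_F2_line)
  let ?S = "bracket F2_line ` tuples F2_line 3"
  have S: "?S \<subseteq> carrier F2_line"
    by (auto elim!: tuples_3E)
  \<comment> \<open>Since \<open>e\<close> is a unit, each vector is itself a bracket, even before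
    taking spans.\<close>
  have "bracket F2_line [x, e, e] = x" for x by simp
  moreover have "[x, e, e] \<in> tuples F2_line 3" if "x \<in> carrier F2_line" for x
    using that by (auto simp: tuples_def)
  ultimately have "carrier F2_line \<subseteq> ?S"
    by (metis image_eqI subsetI)
  then show ?thesis
    using lin_span_superset[of ?S] lin_span_least[OF submodule_carrier S]
    unfolding perfect_def by blast
qed

section \<open>Its tensor square\<close>

abbreviation "F \<equiv> tensor_free F2 F2_line 2"
abbreviation "N \<equiv> tensor_relations F2 F2_line 2"

interpretation F: module F2 F
  by (intro cring.free_module_module cring_F2)

lemma unit_vec_in_F: "xs \<in> tuples F2_line 2 \<Longrightarrow> unit_vec F2 xs \<in> carrier F"
  by (intro cring.unit_vec_closed cring_F2)

lemma tuples_update: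
  "xs \<in> tuples V m \<Longrightarrow> x \<in> carrier V \<Longrightarrow> xs[i := x] \<in> tuples V m"
  unfolding tuples_def using set_update_subset_insert[of xs i x] by auto

text \<open>Characteristic two: the differences in the tensor relations become pointwise sums, whose
  coefficients can be computed.\<close>

lemma uminus_F: "f \<in> carrier F \<Longrightarrow> \<ominus>\<^bsub>F\<^esub> f = f"
proof -
  assume "f \<in> carrier F"
  moreover have "f \<oplus>\<^bsub>F\<^esub> f = \<zero>\<^bsub>F\<^esub>" by simp
  ultimately show ?thesis by (simp add: F.M.minus_equality del: free_module_simps)
qed

lemma minus_F: "g \<in> carrier F \<Longrightarrow> f \<ominus>\<^bsub>F\<^esub> g = (\<lambda>b. f b \<oplus>\<^bsub>F2\<^esub> g b)"
  by (simp add: a_minus_def uminus_F)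

lemma relation_generators_closed:
  assumes "xs \<in> tuples F2_line 2" "x \<in> carrier F2_line" "y \<in> carrier F2_line" "a \<in> carrier F2"
  shows "unit_vec F2 (xs[i := x \<oplus>\<^bsub>F2_line\<^esub> y]) \<ominus>\<^bsub>F\<^esub>
      (unit_vec F2 (xs[i := x]) \<oplus>\<^bsub>F\<^esub> unit_vec F2 (xs[i := y])) \<in> carrier F"
    and "unit_vec F2 (xs[i := a \<odot>\<^bsub>F2_line\<^esub> x]) \<ominus>\<^bsub>F\<^esub> (a \<odot>\<^bsub>F\<^esub> unit_vec F2 (xs[i := x])) \<in> carrier F"
proof -
  interpret L: module F2 F2_line by (rule module_F2_line)
  \<comment> \<open>The closure rules apply only while carriers and operations remain
    folded.\<close>
  note [simp del] = free_module_simps F2_line_simps F2_simps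
  show "unit_vec F2 (xs[i := x \<oplus>\<^bsub>F2_line\<^esub> y]) \<ominus>\<^bsub>F\<^esub>
      (unit_vec F2 (xs[i := x]) \<oplus>\<^bsub>F\<^esub> unit_vec F2 (xs[i := y])) \<in> carrier F"
   "unit_vec F2 (xs[i := a \<odot>\<^bsub>F2_line\<^esub> x]) \<ominus>\<^bsub>F\<^esub> (a \<odot>\<^bsub>F\<^esub> unit_vec F2 (xs[i := x])) \<in> carrier F"
    using assms by (auto intro!: F.M.minus_closed F.M.a_closed F.smult_closed unit_vec_in_F tuples_update)
qed

lemma submodule_N: "submodule N F2 F"
  unfolding tensor_relations_def
  by (rule F.submodule_lin_span) (use relation_generators_closed in blast)

text \<open>Of the four basis tuples only \<open>[e, e]\<close> has a nonzero product, so the coefficient at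
  \<open>[e, e]\<close> is the functional on the free space induced by multiplication.\<close>

lemma N_coefficient:
  assumes "f \<in> N"
  shows "f [e, e] = 0"
proof -
  \<comment> \<open>The kernel of the functional. It suffices that it contains the generators of
    \<open>N\<close>.\<close>
  let ?H = "{f \<in> carrier F. f [e, e] = 0}"
  have H: "submodule ?H F2 F"
    using F.M.a_closed F.smult_closed uminus_F by (intro F.submoduleI) auto
  have "N \<subseteq> ?H"
    unfolding tensor_relations_def
  proof (rule F.lin_span_least[OF H], safe)
    fix xs x y and i :: nat
    assume *: "xs \<in> tuples F2_line 2" "i < 2" "x \<in> carrier F2_line" "y \<in> carrier F2_line"
    let ?f = "unit_vec F2 (xs[i := x \<oplus>\<^bsub>F2_line\<^esub> y])"
    let ?g = "unit_vec F2 (xs[i := x]) \<oplus>\<^bsub>F\<^esub> unit_vec F2 (xs[i := y])"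
    show "?f \<ominus>\<^bsub>F\<^esub> ?g \<in> carrier F"
      using relation_generators_closed * by blast
    have L: "x \<oplus>\<^bsub>F2_line\<^esub> y \<in> carrier F2_line"
      using * by auto
    have "?f \<in> carrier F" "?g \<in> carrier F"
      using * L by (blast intro: F.M.a_closed unit_vec_in_F tuples_update)+
    then have "(?f \<ominus>\<^bsub>F\<^esub> ?g) [e, e] = ?f [e, e] \<oplus>\<^bsub>F2\<^esub> ?g [e, e]"
      by (simp add: minus_F del: free_module_simps)
    moreover from \<open>i < 2\<close> have "i = 0 \<or> i = 1" by auto
    \<comment> \<open>If the entry of \<open>xs\<close> at the other position is zero, all
      coefficients vanish. If it is \<open>e\<close>, the coefficient belonging to a vector at
      position \<open>i\<close> is 1 exactly for \<open>e\<close>, which is additive because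
      \<open>e\<close> plus \<open>e\<close> is zero.\<close>
    ultimately show "(?f \<ominus>\<^bsub>F\<^esub> ?g) [e, e] = 0"
      using * by (auto elim!: tuples_2E simp: unit_vec_def fun_eq_iff)
  next
    fix xs a x and i :: nat
    assume *: "xs \<in> tuples F2_line 2" "i < 2" "a \<in> carrier F2" "x \<in> carrier F2_line"
    let ?f = "unit_vec F2 (xs[i := a \<odot>\<^bsub>F2_line\<^esub> x])"
    let ?g = "a \<odot>\<^bsub>F\<^esub> unit_vec F2 (xs[i := x])"
    show "?f \<ominus>\<^bsub>F\<^esub> ?g \<in> carrier F"
      using relation_generators_closed * by blast
    have L: "a \<odot>\<^bsub>F2_line\<^esub> x \<in> carrier F2_line"
      using * by auto
    have "?f \<in> carrier F" "?g \<in> carrier F"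
      using * L by (blast intro: F.smult_closed unit_vec_in_F tuples_update)+
    then have "(?f \<ominus>\<^bsub>F\<^esub> ?g) [e, e] = ?f [e, e] \<oplus>\<^bsub>F2\<^esub> ?g [e, e]"
      by (simp add: minus_F del: free_module_simps)
    moreover from \<open>i < 2\<close> have "i = 0 \<or> i = 1" by auto
    ultimately show "(?f \<ominus>\<^bsub>F\<^esub> ?g) [e, e] = 0"
      using * by (auto elim!: tuples_2E simp: unit_vec_def fun_eq_iff)
  qed
  then show ?thesis using assms by blast
qed

text \<open>A tuple with a zero entry is still a nonzero basis vector of the free space. The scaling
  relation with scalar 0 and vector \<open>e\<close> has this basis vector as its first term and
  zero as its second.\<close>

lemma unit_vec_zero_entry:
  assumes xs: "xs \<in> tuples F2_line 2" and i: "i < 2"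
  shows "unit_vec F2 (xs[i := \<lambda>_. 0]) \<in> N"
proof -
  let ?f = "unit_vec F2 (xs[i := 0 \<odot>\<^bsub>F2_line\<^esub> e]) \<ominus>\<^bsub>F\<^esub> (0 \<odot>\<^bsub>F\<^esub> unit_vec F2 (xs[i := e]))"
  have "?f \<in> N"
    unfolding tensor_relations_def
    by (rule subsetD[OF F.lin_span_superset], rule UnI2) (use assms in force)
  moreover have "unit_vec F2 (xs[i := \<lambda>_. 0]) \<in> carrier F"
    by (intro unit_vec_in_F tuples_update xs) simp
  then have "?f = unit_vec F2 (xs[i := \<lambda>_. 0])"
    by (subst minus_F) (auto simp: unit_vec_def)
  ultimately show ?thesis by simp
qed

text \<open>If \<open>ys\<close> is \<open>[e, e]\<close>, it acts as the identity, so both summands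
  are \<open>unit_vec F2 xs\<close> and cancel. Any other \<open>ys\<close> has a zero entry, so
  each summand is a basis vector of a tuple with a zero entry.\<close>

lemma dt_bracket_of_tuples:
  assumes xs: "xs \<in> tuples F2_line 2" and ys: "ys \<in> tuples F2_line 2"
  shows "(\<Oplus>\<^bsub>F\<^esub>i\<in>{..<2}. unit_vec F2 (xs[i := bracket F2_line (xs ! i # ys)])) \<in> N"
proof (cases "ys = [e, e]")
  case True
  then have "xs[i := bracket F2_line (xs ! i # ys)] = xs" for i
    by simp
  moreover have "{..<2::nat} = {0, 1}" by auto
  ultimately show ?thesis
    using unit_vec_in_F[OF xs] F.submodule_memD(2)[OF submodule_N]
    by (simp del: F2_line_simps free_module_simps) simp
next
  case False
  then have "bracket F2_line (x # ys) = (\<lambda>_. 0)" for x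
    using ys by (auto elim!: tuples_2E)
  then show ?thesis
    using unit_vec_zero_entry[OF xs]
    by (intro F.submodule_finsum[OF submodule_N]) simp
qed

lemma dt_free_bracket_in_N:
  assumes "f \<in> carrier F" "g \<in> carrier F"
  shows "dt_free_bracket F2 2 F2_line f g \<in> N"
  unfolding dt_free_bracket_def
  by (rule F.submodule_linear_extension[OF submodule_N assms(1)],
      rule F.submodule_linear_extension[OF submodule_N assms(2)], rule dt_bracket_of_tuples)

section \<open>The Daletskii-Takhtajan algebra of the line\<close>

abbreviation "D \<equiv> daletskii_takhtajan F2 3 F2_line"

lemma D_simps:
  "carrier D = a_rcosets\<^bsub>F\<^esub> N" "\<zero>\<^bsub>D\<^esub> = N"
  by (simp_all add: daletskii_takhtajan_def tensor_power_def quotient_module_def module.defs)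

text \<open>The record \<open>D\<close> extends the tensor square by a bracket and keeps its module
  operations, so the axioms carry over.\<close>

lemma module_D: "module F2 D"
proof -
  interpret Q: module F2 "tensor_power F2 F2_line 2"
    unfolding tensor_power_def by (rule F.quotient_module_module[OF submodule_N])
  have eq: "carrier D = carrier (tensor_power F2 F2_line 2)"
    "add D = add (tensor_power F2 F2_line 2)" "zero D = zero (tensor_power F2 F2_line 2)"
    "smult D = smult (tensor_power F2 F2_line 2)"
    by (simp_all add: daletskii_takhtajan_def module.defs)
  have "abelian_group D"
    by (rule abelian_groupI) (auto simp: eq Q.M.a_ac intro: Q.M.l_neg)
  then show ?thesis
    by (intro moduleI cring_F2)
      (auto simp: eq Q.smult_l_distr Q.smult_r_distr Q.smult_assoc1 simp del: F2_simps)
qed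

text \<open>All free brackets of representatives lie in \<open>N\<close>, so every coset in the
  union defining the bracket is \<open>N\<close> itself, the zero of \<open>D\<close>.\<close>

lemma bracket_D:
  assumes "Xs \<in> tuples D 2"
  shows "bracket D Xs = \<zero>\<^bsub>D\<^esub>"
proof -
  interpret Q: abelian_subgroup N F
    by (rule F.submodule_abelian_subgroup[OF submodule_N])
  obtain X Y where XY: "Xs = [X, Y]" "X \<in> a_rcosets\<^bsub>F\<^esub> N" "Y \<in> a_rcosets\<^bsub>F\<^esub> N"
    using assms by (metis tuples_2E D_simps(1))
  then have sub: "X \<subseteq> carrier F" "Y \<subseteq> carrier F"
    using Q.a_rcosets_carrier by blast+
  \<comment> \<open>Needed for the union to be \<open>N\<close> rather than empty.\<close>
  have ne: "X \<noteq> {}" "Y \<noteq> {}"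
    using XY Q.a_rcos_self by (auto simp: A_RCOSETS_def' simp del: free_module_simps)
  have "bracket D Xs = (\<Union>f\<in>X. \<Union>g\<in>Y. N +>\<^bsub>F\<^esub> dt_free_bracket F2 2 F2_line f g)"
    by (simp add: XY daletskii_takhtajan_def module.defs nary_algebra.defs)
  also have "\<dots> = (\<Union>f\<in>X. \<Union>g\<in>Y. N)"
    using sub dt_free_bracket_in_N Q.a_rcos_const by (intro SUP_cong refl) blast
  also have "\<dots> = N" using ne by simp
  finally show ?thesis by (simp add: D_simps)
qed

text \<open>With a vanishing bracket, multilinearity and both sides of the fundamental identity
  reduce to identities about zero.\<close>

lemma leibniz_D: "leibniz_algebra F2 D"
proof -
  interpret field F2 by (rule field_F2)
  interpret D: module F2 D by (rule module_D)
  note [simp del] = F2_simps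
  show ?thesis
  proof
    show "multilinear F2 D 2 (bracket D)"
      by (simp add: multilinear_def bracket_D tuples_update)
  next
    fix Xs Ys assume Xs: "Xs \<in> tuples D 2" and Ys: "Ys \<in> tuples D (2 - 1)"
    have cons: "X # Ys \<in> tuples D 2" if "X \<in> carrier D" for X
      using Ys that by (auto simp: tuples_def)
    have "Xs ! i \<in> carrier D" if "i < 2" for i
      using Xs that by (auto simp: tuples_def)
    then have "(\<Oplus>\<^bsub>D\<^esub>i\<in>{..<2}. bracket D (Xs[i := bracket D (Xs ! i # Ys)])) = (\<Oplus>\<^bsub>D\<^esub>i\<in>{..<2::nat}. \<zero>\<^bsub>D\<^esub>)"
      using Xs by (intro D.M.finsum_cong') (auto simp: bracket_D cons tuples_update)
    then show "bracket D (bracket D Xs # Ys) =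
        (\<Oplus>\<^bsub>D\<^esub>i\<in>{..<2}. bracket D (Xs[i := bracket D (Xs ! i # Ys)]))"
      using Xs by (simp add: bracket_D cons)
  qed
qed

text \<open>The brackets span only zero, so perfectness would make \<open>N\<close> the only coset.
  The class of \<open>[e, e]\<close> refutes this, because its coefficient at \<open>[e, e]\<close>
  is 1 while elements of \<open>N\<close> have coefficient 0 there.\<close>

lemma not_perfect_D: "\<not> perfect F2 2 D"
proof
  interpret D: module F2 D by (rule module_D)
  interpret Q: abelian_subgroup N F
    by (rule F.submodule_abelian_subgroup[OF submodule_N])
  assume "perfect F2 2 D"
  moreover have "submodule {\<zero>\<^bsub>D\<^esub>} F2 D"
    by (rule D.submoduleI) (auto simp del: F2_simps)
  then have "lin_span F2 D (bracket D ` tuples D 2) \<subseteq> {\<zero>\<^bsub>D\<^esub>}"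
    by (rule D.lin_span_least) (auto simp: bracket_D)
  ultimately have "a_rcosets\<^bsub>F\<^esub> N \<subseteq> {N}"
    by (simp add: perfect_def D_simps)
  moreover have u: "unit_vec F2 [e, e] \<in> carrier F"
    by (rule unit_vec_in_F) (simp add: tuples_def)
  ultimately have "N +>\<^bsub>F\<^esub> unit_vec F2 [e, e] = N"
    unfolding A_RCOSETS_def' by blast
  then have "unit_vec F2 [e, e] \<in> N"
    using Q.a_rcos_self[OF u] by simp
  then show False
    using N_coefficient by (fastforce simp: unit_vec_def)
qed

theorem mainTheorem6:
  shows "\<exists>(K :: real ring) (n :: nat) (L :: (real, nat \<Rightarrow> real) nary_algebra).
    field K \<and> n \<ge> 2 \<and> leibniz_n_algebra K n L \<and> perfect K n L \<and>
    leibniz_algebra K (daletskii_takhtajan K n L) \<and>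
    \<not> perfect K 2 (daletskii_takhtajan K n L)"
proof (intro exI conjI)
  show "2 \<le> (3::nat)" by simp
qed (rule field_F2 leibniz_F2_line perfect_F2_line leibniz_D not_perfect_D)+

end
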